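(* Let $d\ge 2$ and $1\le l<k<\infty$ be integers. For every $p\in[0,1/d^l]$, $$\frac{1-pd^l}{d^k}\le q_c(p)\le\frac{1-pd^l}{(1-p)d^k},$$ where $q_c(p)$ is the critical parameter of the two-edge long-range percolation model (lengths $l$ and $k$) on the rooted oriented $d$-ary tree, as defined in the context.
   Context: Model: on the rooted oriented $d$-ary tree with root $o$ (every vertex has $d$ children), add for each vertex $v$ oriented edges of length $l$ from $v$ to each of its $d^l$ descendants exactly $l$ generations below, and oriented edges of length $k$ from $v$ to each of its $d^k$ descendants exactly $k$ generations below. Each edge of length $l$ is open with probability $p$ and each edge of length $k$ is open with probability $q$, all independently; only these edges are used for percolation. An open path is a sequence of vertices connected by (oriented) open edges; $\mathcal{C}(o)$ is the set of vertices $w$ such that there is an open path from $o$ to $w$, and $\theta(p,q)=\mathbb{P}(|\mathcal{C}(o)|=\infty)$. Define $q_c(p)=\inf\{q\in(0,1):\theta(p,q)>0\}$. *)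

theory Defs
  imports "HOL-Probability.Probability"
begin

text \<open>
  A vertex of the rooted \<open>d\<close>-ary tree is the word over \<open>{0..<d}\<close> read along the path
  from the root, so the root is the empty word and the descendants of \<open>v\<close> exactly
  \<open>n\<close> generations below it are the words \<open>v @ u\<close> with \<open>u\<close> of length \<open>n\<close>.
\<close>

definition tree_vertices :: "nat \<Rightarrow> nat list set" where
  "tree_vertices d = lists {0..<d}"

definition edges_of_length :: "nat \<Rightarrow> nat \<Rightarrow> (nat list \<times> nat list) set" where
  "edges_of_length d n =
     {(v, v @ u) | v u. v \<in> tree_vertices d \<and> u \<in> tree_vertices d \<and> length u = n}"

definition perc_edges :: "nat \<Rightarrow> nat \<Rightarrow> nat \<Rightarrow> (nat list \<times> nat list) set" where
  "perc_edges d l k = edges_of_length d l \<union> edges_of_length d k"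

text \<open>
  A configuration sends each edge to \<open>True\<close> (open) or \<open>False\<close> (closed). For \<open>l \<noteq> k\<close> the
  two edge sets are disjoint. Outside \<open>[0,1]\<close> the parameter of \<open>bernoulli_pmf\<close> is clamped
  to that interval.
\<close>

definition perc_measure ::
    "nat \<Rightarrow> nat \<Rightarrow> nat \<Rightarrow> real \<Rightarrow> real \<Rightarrow> (nat list \<times> nat list \<Rightarrow> bool) measure" where
  "perc_measure d l k p q =
     (\<Pi>\<^sub>M e\<in>perc_edges d l k.
        measure_pmf (bernoulli_pmf (if e \<in> edges_of_length d l then p else q)))"

definition cluster ::
    "nat \<Rightarrow> nat \<Rightarrow> nat \<Rightarrow> (nat list \<times> nat list \<Rightarrow> bool) \<Rightarrow> nat list \<Rightarrow> nat list set" where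
  "cluster d l k \<omega> v = {w. (v, w) \<in> {e \<in> perc_edges d l k. \<omega> e}\<^sup>*}"

definition theta :: "nat \<Rightarrow> nat \<Rightarrow> nat \<Rightarrow> real \<Rightarrow> real \<Rightarrow> real" where
  "theta d l k p q =
     measure (perc_measure d l k p q)
       {\<omega> \<in> space (perc_measure d l k p q). infinite (cluster d l k \<omega> [])}"

text \<open>
  \<open>Inf\<close> is the infimum in the reals, which is meaningful only for a nonempty set; no
  convention for an empty set is imposed.
\<close>

definition q_crit :: "nat \<Rightarrow> nat \<Rightarrow> nat \<Rightarrow> real \<Rightarrow> real" where
  "q_crit d l k p = Inf {q. 0 < q \<and> q < 1 \<and> theta d l k p q > 0}"

end

theory Submission
  imports Defs
begin

text \<open>
  Below the lower bound the expected number of open paths with \<open>n\<close> edges,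
  \<open>(p d^l + q d^k)^n\<close>, tends to \<open>0\<close>. For the upper bound, count only those open paths
  whose \<open>k\<close>-edges point to vertices with a closed incoming \<open>l\<close>-edge. Their expected number
  is \<open>m^n\<close> with \<open>m = p d^l + (1 - p) q d^k\<close>. Two such paths that split either never meet again,
  and are then independent after the splitting point, or are incompatible. Hence the second
  moment is at most \<open>m^(2n) m / (m - 1)\<close> for \<open>m > 1\<close>, and such a path exists with probability
  at least \<open>(m - 1) / m\<close> for every \<open>n\<close>.
\<close>

section \<open>Words and the requirements collected along a path\<close>

lemma card_tree_vertices_of_length:
  "finite {u \<in> tree_vertices d. length u = n}" "card {u \<in> tree_vertices d. length u = n} = d ^ n"
proof -
  have eq: "{u \<in> tree_vertices d. length u = n} = {u. set u \<subseteq> {0..<d} \<and> length u = n}"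
    by (auto simp: tree_vertices_def lists_eq_set)
  show "finite {u \<in> tree_vertices d. length u = n}"
    unfolding eq by (rule finite_lists_length_eq) simp
  show "card {u \<in> tree_vertices d. length u = n} = d ^ n"
    unfolding eq by (subst card_lists_length_eq) auto
qed

text \<open>Used to see that a path with \<open>n\<close> edges reaches depth at least
  \<open>n\<close>, since no jump is empty.\<close>

lemma length_le_length_concat: "[] \<notin> set us \<Longrightarrow> length us \<le> length (concat us)"
proof (induction us)
  case (Cons u us)
  then show ?case by (cases u) auto
qed simp

text \<open>\<open>st v u\<close> lists the edge states that a step from \<open>v\<close> to
  \<open>v @ u\<close> demands. A path is coded by its increments \<open>us\<close> rather than its
  vertices, so the same index set of paths serves every starting vertex. The parameter
  \<open>st\<close> allows plain open paths and the restricted paths of the upper bound to share all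
  general facts.\<close>

fun trace ::
    "(nat list \<Rightarrow> nat list \<Rightarrow> ((nat list \<times> nat list) \<times> bool) set) \<Rightarrow> nat list \<Rightarrow> nat list list
      \<Rightarrow> ((nat list \<times> nat list) \<times> bool) set" where
  "trace st v [] = {}"
| "trace st v (u # us) = st v u \<union> trace st (v @ u) us"

lemma trace_append: "trace st v (us @ vs) = trace st v us \<union> trace st (v @ concat us) vs"
  by (induction us arbitrary: v) auto

lemma trace_take: "trace st v (take n us) \<subseteq> trace st v us"
  using trace_append[of st v "take n us" "drop n us"] by simp

definition open_step :: "nat list \<Rightarrow> nat list \<Rightarrow> ((nat list \<times> nat list) \<times> bool) set" where
  "open_step v u = {((v, v @ u), True)}"

section \<open>The product measure and cylinder events\<close>

locale two_range_percolation =
  fixes d l k :: nat and p q :: real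
  assumes l_pos: "0 < l" and l_less_k: "l < k"
    and p_nonneg: "0 \<le> p" and p_le_1: "p \<le> 1" and q_nonneg: "0 \<le> q" and q_le_1: "q \<le> 1"
begin

definition edge_prob :: "nat list \<times> nat list \<Rightarrow> real" where
  "edge_prob e = (if e \<in> edges_of_length d l then p else q)"

abbreviation "E \<equiv> perc_edges d l k"
abbreviation "M \<equiv> perc_measure d l k p q"

lemma edge_prob_bounds: "0 \<le> edge_prob e" "edge_prob e \<le> 1"
  by (auto simp: edge_prob_def p_nonneg p_le_1 q_nonneg q_le_1)

sublocale product_prob_space "\<lambda>e. measure_pmf (bernoulli_pmf (edge_prob e))" E
  by unfold_locales

lemma M_eq: "M = (\<Pi>\<^sub>M e\<in>E. measure_pmf (bernoulli_pmf (edge_prob e)))"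
  unfolding perc_measure_def edge_prob_def ..

sublocale M: prob_space M
  unfolding M_eq by (rule P.prob_space_axioms)

text \<open>A pair in \<open>S\<close> is an edge with its demanded state. Contradictory demands are
  allowed and give the empty event; pairs of incompatible paths rely on this.\<close>

definition cyl :: "((nat list \<times> nat list) \<times> bool) set \<Rightarrow> (nat list \<times> nat list \<Rightarrow> bool) set" where
  "cyl S = {\<omega> \<in> space M. \<forall>x\<in>S. \<omega> (fst x) = snd x}"

abbreviation cprob :: "((nat list \<times> nat list) \<times> bool) set \<Rightarrow> real" where
  "cprob S \<equiv> measure M (cyl S)"

definition admissible :: "((nat list \<times> nat list) \<times> bool) set \<Rightarrow> bool" where
  "admissible S \<longleftrightarrow> finite S \<and> fst ` S \<subseteq> E"

lemma admissible_Un [simp]: "admissible (S \<union> T) \<longleftrightarrow> admissible S \<and> admissible T"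
  by (auto simp: admissible_def)

lemma cyl_Un: "cyl (S \<union> T) = cyl S \<inter> cyl T"
  by (auto simp: cyl_def)

lemma cyl_empty: "cyl {} = space M"
  by (simp add: cyl_def)

lemma cyl_mono: "S \<subseteq> T \<Longrightarrow> cyl T \<subseteq> cyl S"
  by (auto simp: cyl_def)

lemma cyl_conflict: "(e, True) \<in> S \<Longrightarrow> (e, False) \<in> S \<Longrightarrow> cyl S = {}"
proof (rule equals0I)
  fix \<omega> assume S: "(e, True) \<in> S" "(e, False) \<in> S" and "\<omega> \<in> cyl S"
  then have "\<forall>x\<in>S. \<omega> (fst x) = snd x" by (simp add: cyl_def)
  from bspec[OF this S(1)] bspec[OF this S(2)] show False by simp
qed

text \<open>Demands are grouped by edge to fit the product measure. The set of allowed states of an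
  edge is a singleton, or empty if both states are demanded, so the resulting product formula also
  covers contradictory \<open>S\<close> and then gives 0.\<close>

lemma cyl_eq:
  "cyl S = {\<omega> \<in> space M. \<forall>e\<in>fst ` S. \<omega> e \<in> {b. \<forall>b'. (e, b') \<in> S \<longrightarrow> b = b'}}"
  by (fastforce simp: cyl_def)

lemma cprob_eq_prod:
  assumes "admissible S"
  shows "cprob S = (\<Prod>e\<in>fst ` S.
    measure_pmf.prob (bernoulli_pmf (edge_prob e)) {b. \<forall>b'. (e, b') \<in> S \<longrightarrow> b = b'})"
proof -
  have "emeasure M (cyl S) = (\<Prod>e\<in>fst ` S.
    emeasure (bernoulli_pmf (edge_prob e)) {b. \<forall>b'. (e, b') \<in> S \<longrightarrow> b = b'})"
    unfolding cyl_eq M_eq using assms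
    by (intro emeasure_PiM_Collect) (auto simp: admissible_def)
  then show ?thesis
    by (simp add: M.emeasure_eq_measure measure_pmf.emeasure_eq_measure prod_ennreal prod_nonneg)
qed

lemma sets_cyl: assumes "admissible S" shows "cyl S \<in> sets M"
proof -
  have "cyl S = {\<omega> \<in> space M. \<forall>e\<in>fst ` S. \<omega> e \<in> {b. \<forall>b'. (e, b') \<in> S \<longrightarrow> b = b'}}"
    by (rule cyl_eq)
  also have "\<dots> \<in> sets M"
  proof (rule sets.sets_Collect_finite_All)
    fix e assume "e \<in> fst ` S"
    then have "e \<in> E" using assms by (auto simp: admissible_def)
    then show "{\<omega> \<in> space M. \<omega> e \<in> {b. \<forall>b'. (e, b') \<in> S \<longrightarrow> b = b'}} \<in> sets M"
      unfolding M_eq by measurable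
  qed (use assms in \<open>simp add: admissible_def\<close>)
  finally show ?thesis .
qed

lemma cprob_Un:
  assumes "admissible S" "admissible T" "fst ` S \<inter> fst ` T = {}"
  shows "cprob (S \<union> T) = cprob S * cprob T"
proof -
  have *: "(e, b) \<notin> T" if "e \<in> fst ` S" for e b
    using that assms(3) by force
  have **: "(e, b) \<notin> S" if "e \<in> fst ` T" for e b
    using that assms(3) by force
  show ?thesis
    using assms
    by (simp add: cprob_eq_prod image_Un admissible_def prod.union_disjoint * ** cong: prod.cong)
qed

lemma cprob_open:
  assumes "e \<in> E"
  shows "cprob {(e, True)} = edge_prob e"
proof -
  have "{b. \<forall>b'. (e, b') \<in> {(e, True)} \<longrightarrow> b = b'} = {True}" by auto
  with assms edge_prob_bounds[of e] show ?thesis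
    by (subst cprob_eq_prod) (simp_all add: admissible_def measure_pmf_single)
qed

lemma cprob_closed:
  assumes "e \<in> E"
  shows "cprob {(e, False)} = 1 - edge_prob e"
proof -
  have "{b. \<forall>b'. (e, b') \<in> {(e, False)} \<longrightarrow> b = b'} = {False}" by auto
  with assms edge_prob_bounds[of e] show ?thesis
    by (subst cprob_eq_prod) (simp_all add: admissible_def measure_pmf_single)
qed

section \<open>Jump sequences, independence along a path and first moments\<close>

definition jumps :: "nat list set" where
  "jumps = {u \<in> tree_vertices d. length u = l \<or> length u = k}"

text \<open>These sequences code the paths with \<open>n\<close> edges from any fixed
  vertex.\<close>

definition jump_seqs :: "nat \<Rightarrow> nat list list set" where
  "jump_seqs n = {us. set us \<subseteq> jumps \<and> length us = n}"

lemma jumps_eq: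
  "jumps = {u \<in> tree_vertices d. length u = l} \<union> {u \<in> tree_vertices d. length u = k}"
  by (auto simp: jumps_def)

lemma finite_jumps: "finite jumps"
  unfolding jumps_eq by (intro finite_UnI card_tree_vertices_of_length)

lemma finite_jump_seqs: "finite (jump_seqs n)"
  unfolding jump_seqs_def by (rule finite_lists_length_eq[OF finite_jumps])

lemma jump_seqs_0 [simp]: "jump_seqs 0 = {[]}"
  by (auto simp: jump_seqs_def)

lemma sum_jump_seqs_Suc:
  "(\<Sum>us\<in>jump_seqs (Suc n). f us) = (\<Sum>u\<in>jumps. \<Sum>us\<in>jump_seqs n. f (u # us))"
proof -
  have "(\<Sum>us\<in>jump_seqs (Suc n). f us) = (\<Sum>(u, us)\<in>jumps \<times> jump_seqs n. f (u # us))"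
    by (rule sum.reindex_bij_witness[of _ "\<lambda>(u, us). u # us" "\<lambda>us. (hd us, tl us)"])
       (auto simp: jump_seqs_def length_Suc_conv)
  then show ?thesis by (simp add: sum.cartesian_product)
qed

lemma sum_jumps:
  "(\<Sum>u\<in>jumps. if length u = l then a else b) = a * real d ^ l + b * real d ^ k" for a b :: real
proof -
  have "(\<Sum>u\<in>jumps. if length u = l then a else b)
    = (\<Sum>u | u \<in> tree_vertices d \<and> length u = l. if length u = l then a else b)
      + (\<Sum>u | u \<in> tree_vertices d \<and> length u = k. if length u = l then a else b)"
    unfolding jumps_eq using l_less_k
    by (intro sum.union_disjoint card_tree_vertices_of_length) auto
  also have "(\<Sum>u | u \<in> tree_vertices d \<and> length u = l. if length u = l then a else b)
    = (\<Sum>u | u \<in> tree_vertices d \<and> length u = l. a)"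
    by (intro sum.cong) auto
  also have "(\<Sum>u | u \<in> tree_vertices d \<and> length u = k. if length u = l then a else b)
    = (\<Sum>u | u \<in> tree_vertices d \<and> length u = k. b)"
    using l_less_k by (intro sum.cong) auto
  finally show ?thesis by (simp add: card_tree_vertices_of_length)
qed

lemma jumps_tree_vertices: "u \<in> jumps \<Longrightarrow> v \<in> tree_vertices d \<Longrightarrow> v @ u \<in> tree_vertices d"
  by (auto simp: jumps_def tree_vertices_def)

lemma jumps_nonempty: "u \<in> jumps \<Longrightarrow> 0 < length u"
  using l_pos l_less_k by (auto simp: jumps_def)

lemma jump_edge: "v \<in> tree_vertices d \<Longrightarrow> u \<in> jumps \<Longrightarrow> (v, v @ u) \<in> E"
  by (auto simp: jumps_def perc_edges_def edges_of_length_def)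

lemma edge_prob_jump:
  assumes "v \<in> tree_vertices d" "u \<in> jumps"
  shows "edge_prob (v, v @ u) = (if length u = l then p else q)"
  using assms by (auto simp: edge_prob_def edges_of_length_def jumps_def)

text \<open>All edges that a step constrains end at the target of that step. Targets get strictly
  deeper along a path, so different steps constrain different edges and are independent, even when a
  step looks at edges off the path.\<close>

definition local_step ::
    "(nat list \<Rightarrow> nat list \<Rightarrow> ((nat list \<times> nat list) \<times> bool) set) \<Rightarrow> bool" where
  "local_step st \<longleftrightarrow> (\<forall>v\<in>tree_vertices d. \<forall>u\<in>jumps.
     admissible (st v u) \<and> snd ` fst ` st v u \<subseteq> {v @ u})"

lemma admissible_trace:
  assumes "local_step st" "v \<in> tree_vertices d" "set us \<subseteq> jumps"
  shows "admissible (trace st v us)"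
  using assms(2,3)
proof (induction us arbitrary: v)
  case Nil
  show ?case by (simp add: admissible_def)
next
  case (Cons u us)
  then show ?case using assms(1) jumps_tree_vertices by (auto simp: local_step_def)
qed

lemma trace_target_deeper:
  assumes "local_step st" "v \<in> tree_vertices d" "set us \<subseteq> jumps" "((y, z), b) \<in> trace st v us"
  shows "length v < length z"
  using assms(2,3,4)
proof (induction us arbitrary: v)
  case (Cons u us)
  have u: "u \<in> jumps" "set us \<subseteq> jumps" using Cons.prems by auto
  have "v @ u \<in> tree_vertices d" using u Cons.prems jumps_tree_vertices by blast
  then have "((y, z), b) \<in> trace st (v @ u) us \<Longrightarrow> length (v @ u) < length z"
    using Cons.IH u by blast
  moreover have "((y, z), b) \<in> st v u \<Longrightarrow> z = v @ u"
    using assms(1) Cons.prems(1) u by (force simp: local_step_def)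
  ultimately show ?case using Cons.prems(3) jumps_nonempty[OF u(1)] by auto
qed simp

lemma step_trace_disjoint:
  assumes "local_step st" "v \<in> tree_vertices d" "u \<in> jumps" "set us \<subseteq> jumps"
  shows "fst ` st v u \<inter> fst ` trace st (v @ u) us = {}"
proof (rule equals0I)
  fix e assume "e \<in> fst ` st v u \<inter> fst ` trace st (v @ u) us"
  then obtain b b' where b: "(e, b) \<in> st v u" "(e, b') \<in> trace st (v @ u) us" by auto
  obtain y z where e: "e = (y, z)" by force
  have "z = v @ u" using assms(1-3) b(1) e by (force simp: local_step_def)
  with trace_target_deeper[OF assms(1) _ assms(4), of "v @ u" y z b'] b(2) e
    jumps_tree_vertices[OF assms(3,2)]
  show False by simp
qed

lemma cprob_trace_Cons:
  assumes "local_step st" "v \<in> tree_vertices d" "u \<in> jumps" "set us \<subseteq> jumps"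
  shows "cprob (trace st v (u # us)) = cprob (st v u) * cprob (trace st (v @ u) us)"
proof -
  have "admissible (st v u)" using assms by (auto simp: local_step_def)
  moreover have "admissible (trace st (v @ u) us)"
    using admissible_trace assms jumps_tree_vertices by blast
  ultimately show ?thesis
    using cprob_Un step_trace_disjoint[OF assms] by simp
qed

text \<open>Independence gives one factor per step, and the sum of the factors over all jumps is the
  same at every vertex. Induction on \<open>n\<close> peels off the first jump, which moves the
  starting vertex; hence \<open>v\<close> is arbitrary.\<close>

lemma sum_cprob_trace:
  assumes st: "local_step st"
    and w: "\<And>v u. v \<in> tree_vertices d \<Longrightarrow> u \<in> jumps \<Longrightarrow> cprob (st v u) = (if length u = l then a else b)"
    and "v \<in> tree_vertices d"
  shows "(\<Sum>us\<in>jump_seqs n. cprob (trace st v us)) = (a * real d ^ l + b * real d ^ k) ^ n"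
  using assms(3)
proof (induction n arbitrary: v)
  case 0
  then show ?case by (simp add: cyl_empty M.prob_space)
next
  case (Suc n)
  have "(\<Sum>us\<in>jump_seqs (Suc n). cprob (trace st v us))
    = (\<Sum>u\<in>jumps. \<Sum>us\<in>jump_seqs n. cprob (st v u) * cprob (trace st (v @ u) us))"
    unfolding sum_jump_seqs_Suc
    by (intro sum.cong refl cprob_trace_Cons st Suc.prems) (auto simp: jump_seqs_def)
  also have "\<dots> = (\<Sum>u\<in>jumps. (if length u = l then a else b) * (a * real d ^ l + b * real d ^ k) ^ n)"
    unfolding sum_distrib_left[symmetric]
    by (intro sum.cong refl) (simp only: w Suc jumps_tree_vertices)
  also have "\<dots> = (a * real d ^ l + b * real d ^ k) ^ Suc n"
    unfolding sum_distrib_right[symmetric] sum_jumps by simp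
  finally show ?case .
qed

section \<open>Open paths, the cluster of the root and the percolation event\<close>

lemma local_open_step: "local_step open_step"
  by (auto simp: local_step_def open_step_def admissible_def jump_edge)

lemma cprob_open_step:
  "v \<in> tree_vertices d \<Longrightarrow> u \<in> jumps \<Longrightarrow> cprob (open_step v u) = (if length u = l then p else q)"
  by (simp add: open_step_def cprob_open jump_edge edge_prob_jump)

text \<open>Translates reachability into jump sequences. Both inductions add or remove the first
  edge, because \<open>trace\<close> is defined from the starting vertex.\<close>

lemma cluster_iff_trace:
  assumes "v \<in> tree_vertices d"
  shows "w \<in> cluster d l k \<omega> v \<longleftrightarrow>
    (\<exists>us. set us \<subseteq> jumps \<and> w = v @ concat us \<and> (\<forall>x\<in>trace open_step v us. \<omega> (fst x) = snd x))"
    (is "_ \<longleftrightarrow> (\<exists>us. ?P v us)")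
proof
  assume "w \<in> cluster d l k \<omega> v"
  then have "(v, w) \<in> {e \<in> E. \<omega> e}\<^sup>*" by (simp add: cluster_def)
  then show "\<exists>us. ?P v us"
  proof (induction rule: converse_rtrancl_induct)
    case base
    show ?case by (rule exI[of _ "[]"]) simp
  next
    case (step v y)
    then obtain us where us: "?P y us" by blast
    from step(1) obtain u where u: "u \<in> jumps" "y = v @ u" "\<omega> (v, y)"
      by (auto simp: perc_edges_def edges_of_length_def jumps_def)
    then have "?P v (u # us)" using us by (auto simp: open_step_def)
    then show ?case by blast
  qed
next
  assume "\<exists>us. ?P v us"
  then obtain us where "?P v us" by blast
  then have "(v, w) \<in> {e \<in> E. \<omega> e}\<^sup>*" using assms
  proof (induction us arbitrary: v)
    case (Cons u us)
    have "v @ u \<in> tree_vertices d" using Cons.prems jumps_tree_vertices by simp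
    with Cons have "(v @ u, w) \<in> {e \<in> E. \<omega> e}\<^sup>*" by simp
    moreover have "(v, v @ u) \<in> {e \<in> E. \<omega> e}"
      using Cons.prems jump_edge by (auto simp: open_step_def)
    ultimately show ?case by (rule converse_rtrancl_into_rtrancl[rotated])
  qed simp
  then show "w \<in> cluster d l k \<omega> v" by (simp add: cluster_def)
qed

definition long_path :: "nat \<Rightarrow> (nat list \<times> nat list \<Rightarrow> bool) set" where
  "long_path n = (\<Union>us\<in>jump_seqs n. cyl (trace open_step [] us))"

lemma root_vertex [simp]: "[] \<in> tree_vertices d"
  by (simp add: tree_vertices_def)

lemma take_jump_seqs: "set us \<subseteq> jumps \<Longrightarrow> n \<le> length us \<Longrightarrow> take n us \<in> jump_seqs n"
  by (auto simp: jump_seqs_def dest: in_set_takeD)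

text \<open>If no open path has \<open>n\<close> edges, truncation shows that all open paths have
  fewer, and finitely many jumps leave finitely many endpoints. Conversely, open paths with
  \<open>n\<close> edges for every \<open>n\<close> give cluster vertices of unbounded
  depth.\<close>

lemma infinite_cluster_eq_long_paths:
  "{\<omega> \<in> space M. infinite (cluster d l k \<omega> [])} = (\<Inter>n. long_path n)"
proof (intro equalityI subsetI)
  fix \<omega> assume \<omega>: "\<omega> \<in> {\<omega> \<in> space M. infinite (cluster d l k \<omega> [])}"
  show "\<omega> \<in> (\<Inter>n. long_path n)"
  proof (rule ccontr)
    assume "\<omega> \<notin> (\<Inter>n. long_path n)"
    then obtain n where n: "\<omega> \<notin> long_path n" by blast
    have "cluster d l k \<omega> [] \<subseteq> concat ` {us. set us \<subseteq> jumps \<and> length us \<le> n}"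
    proof
      fix w assume "w \<in> cluster d l k \<omega> []"
      then obtain us where us: "set us \<subseteq> jumps" "w = concat us"
        "\<forall>x\<in>trace open_step [] us. \<omega> (fst x) = snd x"
        using cluster_iff_trace[of "[]" w \<omega>] by auto
      have "length us < n"
      proof (rule ccontr)
        assume "\<not> length us < n"
        then have "take n us \<in> jump_seqs n" using us take_jump_seqs by simp
        moreover have "\<omega> \<in> cyl (trace open_step [] (take n us))"
          using us(3) trace_take[of open_step "[]" n us] \<omega> by (auto simp: cyl_def)
        ultimately show False using n by (auto simp: long_path_def)
      qed
      then show "w \<in> concat ` {us. set us \<subseteq> jumps \<and> length us \<le> n}" using us by auto
    qed
    then have "finite (cluster d l k \<omega> [])"
      using finite_lists_length_le[OF finite_jumps] by (rule finite_subset[OF _ finite_imageI])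
    with \<omega> show False by simp
  qed
next
  fix \<omega> assume \<omega>: "\<omega> \<in> (\<Inter>n. long_path n)"
  then have space: "\<omega> \<in> space M" by (auto simp: long_path_def cyl_def)
  have "\<exists>w\<in>cluster d l k \<omega> []. n \<le> length w" for n
  proof -
    from \<omega> have "\<omega> \<in> long_path n" by blast
    then obtain us where us: "us \<in> jump_seqs n" "\<omega> \<in> cyl (trace open_step [] us)"
      by (auto simp: long_path_def)
    then have "concat us \<in> cluster d l k \<omega> []"
      using cluster_iff_trace[of "[]" "concat us" \<omega>] by (auto simp: jump_seqs_def cyl_def)
    moreover have "n \<le> length (concat us)"
      using us(1) length_le_length_concat[of us] jumps_nonempty by (force simp: jump_seqs_def)
    ultimately show ?thesis by blast
  qed
  note long = this
  have "infinite (cluster d l k \<omega> [])"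
  proof
    assume fin: "finite (cluster d l k \<omega> [])"
    obtain w where w: "w \<in> cluster d l k \<omega> []"
      "Suc (Max (length ` cluster d l k \<omega> [])) \<le> length w" using long by blast
    then have "length w \<le> Max (length ` cluster d l k \<omega> [])" using fin by simp
    with w show False by simp
  qed
  with space show "\<omega> \<in> {\<omega> \<in> space M. infinite (cluster d l k \<omega> [])}" by simp
qed

lemma sets_long_path: "long_path n \<in> sets M"
  unfolding long_path_def
  by (intro sets.finite_UN finite_jump_seqs sets_cyl admissible_trace local_open_step)
     (auto simp: jump_seqs_def)

lemma decseq_long_path: "decseq long_path"
proof (rule decseq_SucI, rule subsetI)
  fix n \<omega> assume "\<omega> \<in> long_path (Suc n)"
  then obtain us where us: "us \<in> jump_seqs (Suc n)" "\<omega> \<in> cyl (trace open_step [] us)"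
    by (auto simp: long_path_def)
  then have "take n us \<in> jump_seqs n" using take_jump_seqs by (simp add: jump_seqs_def)
  moreover have "\<omega> \<in> cyl (trace open_step [] (take n us))"
    using us(2) cyl_mono[OF trace_take] by blast
  ultimately show "\<omega> \<in> long_path n" by (auto simp: long_path_def)
qed

text \<open>Continuity from above along the decreasing events \<open>long_path n\<close>. Both
  bounds on \<open>theta\<close> come from bounds on \<open>long_path n\<close> for each
  \<open>n\<close>.\<close>

lemma long_path_tendsto_theta: "(\<lambda>n. measure M (long_path n)) \<longlonglongrightarrow> theta d l k p q"
  unfolding theta_def infinite_cluster_eq_long_paths
  by (intro M.finite_Lim_measure_decseq decseq_long_path) (auto simp: sets_long_path)

section \<open>No percolation below the lower bound, by a union bound over paths\<close>

lemma theta_eq_0: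
  assumes "p * real d ^ l + q * real d ^ k < 1"
  shows "theta d l k p q = 0"
proof -
  let ?m = "p * real d ^ l + q * real d ^ k"
  have le: "measure M (long_path n) \<le> ?m ^ n" for n
  proof -
    have "measure M (long_path n) \<le> (\<Sum>us\<in>jump_seqs n. cprob (trace open_step [] us))"
      unfolding long_path_def
      by (intro M.finite_measure_subadditive_finite finite_jump_seqs)
         (auto simp: jump_seqs_def intro!: sets_cyl admissible_trace local_open_step)
    also have "\<dots> = ?m ^ n"
      by (rule sum_cprob_trace[OF local_open_step cprob_open_step]) simp_all
    finally show ?thesis .
  qed
  have "(\<lambda>n. ?m ^ n) \<longlonglongrightarrow> 0"
    using assms p_nonneg q_nonneg by (intro LIMSEQ_power_zero) simp
  then have "(\<lambda>n. measure M (long_path n)) \<longlonglongrightarrow> 0"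
    by (rule Lim_null_comparison[rotated]) (simp add: le)
  with long_path_tendsto_theta show ?thesis by (rule LIMSEQ_unique)
qed

section \<open>Exclusive steps and their probabilities\<close>

text \<open>
  A jump of length \<open>k\<close> into \<open>z\<close> only counts when the \<open>l\<close>-edge into \<open>z\<close> is closed. Every vertex then
  has at most one predecessor, read off from the edges pointing to it.
\<close>

definition exclusive_step :: "nat list \<Rightarrow> nat list \<Rightarrow> ((nat list \<times> nat list) \<times> bool) set" where
  "exclusive_step v u = insert ((v, v @ u), True)
     (if length u = l then {} else {((take (length (v @ u) - l) (v @ u), v @ u), False)})"

lemma short_edge_into:
  assumes "v \<in> tree_vertices d" "u \<in> jumps"
  shows "(take (length (v @ u) - l) (v @ u), v @ u) \<in> edges_of_length d l"
proof -
  let ?z = "v @ u"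
  have z: "?z \<in> tree_vertices d" using assms jumps_tree_vertices by blast
  then have "take (length ?z - l) ?z \<in> tree_vertices d" "drop (length ?z - l) ?z \<in> tree_vertices d"
    by (auto simp: tree_vertices_def dest!: in_set_takeD in_set_dropD simp del: take_append drop_append)
  moreover have "length (drop (length ?z - l) ?z) = l"
    using assms(2) l_less_k by (auto simp: jumps_def simp del: drop_append)
  moreover have "?z = take (length ?z - l) ?z @ drop (length ?z - l) ?z"
    by (rule append_take_drop_id[symmetric])
  ultimately show ?thesis unfolding edges_of_length_def by blast
qed

text \<open>In the second case \<open>y\<close> lies \<open>l\<close> generations above the target
  and hence, as \<open>l < k\<close>, strictly below \<open>v\<close>. The demanded open edge and
  the demanded closed edge are therefore distinct, which makes their states independent.\<close>

lemma exclusive_step_cases: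
  assumes "v \<in> tree_vertices d" "u \<in> jumps"
  obtains "length u = l" "exclusive_step v u = {((v, v @ u), True)}"
  | y where "length u = k" "exclusive_step v u = {((v, v @ u), True)} \<union> {((y, v @ u), False)}"
      "(y, v @ u) \<in> edges_of_length d l" "y \<noteq> v"
proof (cases "length u = l")
  case True
  then show ?thesis using that(1) by (simp add: exclusive_step_def)
next
  case False
  then have "length u = k" using assms(2) by (auto simp: jumps_def)
  moreover have "length (take (length (v @ u) - l) (v @ u)) > length v"
    using \<open>length u = k\<close> l_less_k by simp
  then have "take (length (v @ u) - l) (v @ u) \<noteq> v" by (metis less_irrefl)
  ultimately show ?thesis
    using that(2)[OF _ _ short_edge_into[OF assms]] False
    by (simp add: exclusive_step_def insert_commute)
qed

lemma local_exclusive_step: "local_step exclusive_step"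
  unfolding local_step_def
proof (intro ballI)
  fix v u assume vu: "v \<in> tree_vertices d" "u \<in> jumps"
  show "admissible (exclusive_step v u) \<and> snd ` fst ` exclusive_step v u \<subseteq> {v @ u}"
    using vu
  proof (cases rule: exclusive_step_cases)
    case 1
    then show ?thesis using vu by (simp add: admissible_def jump_edge)
  next
    case (2 y)
    then have "(y, v @ u) \<in> E" by (simp add: perc_edges_def)
    with 2(2) show ?thesis using vu by (simp add: admissible_def jump_edge)
  qed
qed

lemma cprob_exclusive_step:
  assumes vu: "v \<in> tree_vertices d" "u \<in> jumps"
  shows "cprob (exclusive_step v u) = (if length u = l then p else (1 - p) * q)"
  using vu
proof (cases rule: exclusive_step_cases)
  case 1
  then show ?thesis by (simp add: cprob_open jump_edge edge_prob_jump vu)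
next
  case (2 y)
  have E: "(v, v @ u) \<in> E" "(y, v @ u) \<in> E"
    using 2 vu jump_edge by (auto simp: perc_edges_def)
  have "cprob (exclusive_step v u) = cprob {((v, v @ u), True)} * cprob {((y, v @ u), False)}"
    unfolding 2(2) using E 2 by (intro cprob_Un) (auto simp: admissible_def)
  also have "\<dots> = q * (1 - p)"
    using E 2 vu l_less_k by (simp add: cprob_open cprob_closed edge_prob_jump) (simp add: edge_prob_def)
  finally show ?thesis using 2 l_less_k by simp
qed

section \<open>Traces of exclusive paths and their conflicts\<close>

lemma trace_open_subset_exclusive: "trace open_step v us \<subseteq> trace exclusive_step v us"
  by (induction us arbitrary: v) (auto simp: open_step_def exclusive_step_def)

text \<open>Reduces a shared constrained edge, possibly one demanded closed, to a vertex that both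
  paths enter.\<close>

lemma exclusive_trace_open_edge:
  "((y, z), b) \<in> trace exclusive_step v us \<Longrightarrow> \<exists>y'. ((y', z), True) \<in> trace exclusive_step v us"
  by (induction us arbitrary: v) (auto simp: exclusive_step_def split: if_splits)

text \<open>Recovers from the demands alone how a path entered \<open>z\<close>, so that two paths
  can be compared at a common target without locating it in the sequences.\<close>

lemma exclusive_trace_jump:
  assumes "v \<in> tree_vertices d" "set us \<subseteq> jumps" "((y, z), True) \<in> trace exclusive_step v us"
  shows "\<exists>w\<in>jumps. z = y @ w \<and>
    (length w = k \<longrightarrow> ((take (length z - l) z, z), False) \<in> trace exclusive_step v us)"
  using assms
proof (induction us arbitrary: v)
  case (Cons u us)
  have "v @ u \<in> tree_vertices d" using Cons.prems jumps_tree_vertices by simp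
  moreover have "((y, z), True) \<in> exclusive_step v u \<Longrightarrow> y = v \<and> z = v @ u"
    by (auto simp: exclusive_step_def split: if_splits)
  ultimately consider "y = v" "z = v @ u" | "((y, z), True) \<in> trace exclusive_step (v @ u) us"
    using Cons.prems(3) by auto
  then show ?case
  proof cases
    case 1
    then show ?thesis using Cons.prems l_less_k
      by (intro bexI[of _ u]) (auto simp: exclusive_step_def)
  next
    case 2
    then show ?thesis using Cons.IH[of "v @ u"] Cons.prems \<open>v @ u \<in> tree_vertices d\<close> by auto
  qed
qed simp

text \<open>Permits walking back along a path: a predecessor is either the start, in which case the
  edge is the first one, or was itself entered.\<close>

lemma exclusive_trace_predecessor:
  assumes "set us \<subseteq> jumps" "((y, z), True) \<in> trace exclusive_step v us"
  shows "(y = v \<and> z = v @ hd us) \<or>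
    (length v < length y \<and> (\<exists>y'. ((y', y), True) \<in> trace exclusive_step v us))"
  using assms
proof (induction us arbitrary: v)
  case (Cons u us)
  have len: "0 < length u" using Cons.prems jumps_nonempty by simp
  have "((y, z), True) \<in> exclusive_step v u \<Longrightarrow> y = v \<and> z = v @ u"
    by (auto simp: exclusive_step_def split: if_splits)
  then consider "y = v" "z = v @ u" | "((y, z), True) \<in> trace exclusive_step (v @ u) us"
    using Cons.prems(2) by auto
  then show ?case
  proof cases
    case 2
    have mem: "((v, v @ u), True) \<in> trace exclusive_step v (u # us)"
      by (simp add: exclusive_step_def)
    from Cons.IH[OF _ 2] Cons.prems consider "y = v @ u"
      | "length (v @ u) < length y" "\<exists>y'. ((y', y), True) \<in> trace exclusive_step (v @ u) us"
      by auto
    then show ?thesis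
    proof cases
      case 1
      with mem len show ?thesis by auto
    next
      case 2
      then show ?thesis by auto
    qed
  qed simp
qed simp

text \<open>
  At the shallowest common target the two paths arrive from different predecessors,
  so one of them requires the \<open>l\<close>-edge there to be open and the other to be closed.
\<close>

lemma exclusive_traces_conflict:
  assumes v: "v \<in> tree_vertices d" and us: "set us \<subseteq> jumps" and vs: "set vs \<subseteq> jumps"
    and hd: "hd us \<noteq> hd vs"
    and "((y, z), True) \<in> trace exclusive_step v us" "((y', z), True) \<in> trace exclusive_step v vs"
  shows "\<exists>e. (e, True) \<in> trace exclusive_step v us \<union> trace exclusive_step v vs \<and>
    (e, False) \<in> trace exclusive_step v us \<union> trace exclusive_step v vs"
  using assms(5,6)
proof (induction "length z" arbitrary: y y' z rule: less_induct)
  case less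
  obtain w where w: "w \<in> jumps" "z = y @ w"
    "length w = k \<longrightarrow> ((take (length z - l) z, z), False) \<in> trace exclusive_step v us"
    using exclusive_trace_jump[OF v us less.prems(1)] by blast
  obtain w' where w': "w' \<in> jumps" "z = y' @ w'"
    "length w' = k \<longrightarrow> ((take (length z - l) z, z), False) \<in> trace exclusive_step v vs"
    using exclusive_trace_jump[OF v vs less.prems(2)] by blast
  show ?case
  proof (cases "y = y'")
    \<comment> \<open>With equal predecessors, \<open>y = v\<close> would make the first jumps
      agree, contrary to \<open>hd\<close>; otherwise \<open>y\<close> is a shallower common target
      and the induction hypothesis applies.\<close>
    case True
    show ?thesis
    proof (cases "y = v")
      case True
      then have "z = v @ hd us"
        using exclusive_trace_predecessor[OF us less.prems(1)] by blast
      moreover have "z = v @ hd vs"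
        using exclusive_trace_predecessor[OF vs less.prems(2)] True \<open>y = y'\<close> by blast
      ultimately show ?thesis using hd by simp
    next
      case False
      then obtain x where "((x, y), True) \<in> trace exclusive_step v us"
        using exclusive_trace_predecessor[OF us less.prems(1)] by blast
      moreover obtain x' where "((x', y), True) \<in> trace exclusive_step v vs"
        using exclusive_trace_predecessor[OF vs less.prems(2)] False \<open>y = y'\<close> by blast
      moreover have "length y < length z" using w jumps_nonempty by simp
      ultimately show ?thesis using less.hyps by blast
    qed
  next
    case False
    with w w' have "length w \<noteq> length w'" by auto
    then consider "length w = l" "length w' = k" | "length w = k" "length w' = l"
      using w(1) w'(1) by (auto simp: jumps_def)
    then show ?thesis
    proof cases
      case 1
      then have "take (length z - l) z = y" using w by simp
      then show ?thesis using 1 w' less.prems by auto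
    next
      case 2
      then have "take (length z - l) z = y'" using w' by simp
      then show ?thesis using 2 w less.prems by auto
    qed
  qed
qed

text \<open>If the paths constrain disjoint edge sets, independence gives equality. If they share an
  edge, they share a target, their demands conflict and the left side is 0.\<close>

lemma cprob_exclusive_pair_le:
  assumes v: "v \<in> tree_vertices d" and us: "set us \<subseteq> jumps" and vs: "set vs \<subseteq> jumps"
    and hd: "hd us \<noteq> hd vs"
  shows "cprob (trace exclusive_step v us \<union> trace exclusive_step v vs)
    \<le> cprob (trace exclusive_step v us) * cprob (trace exclusive_step v vs)"
proof (cases "fst ` trace exclusive_step v us \<inter> fst ` trace exclusive_step v vs = {}")
  case True
  then show ?thesis
    using cprob_Un admissible_trace[OF local_exclusive_step v] us vs by simp
next
  case False
  then obtain y z b b' where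
    "((y, z), b) \<in> trace exclusive_step v us" "((y, z), b') \<in> trace exclusive_step v vs"
    by auto
  then obtain x x' where
    "((x, z), True) \<in> trace exclusive_step v us" "((x', z), True) \<in> trace exclusive_step v vs"
    using exclusive_trace_open_edge by meson
  then obtain e where "(e, True) \<in> trace exclusive_step v us \<union> trace exclusive_step v vs"
    "(e, False) \<in> trace exclusive_step v us \<union> trace exclusive_step v vs"
    using exclusive_traces_conflict[OF v us vs hd] by blast
  then have "cyl (trace exclusive_step v us \<union> trace exclusive_step v vs) = {}"
    by (rule cyl_conflict)
  then show ?thesis by simp
qed

section \<open>Second moment of the number of exclusive paths, and percolation above the upper
  bound\<close>

text \<open>The expected number of exclusive steps available from a vertex.\<close>

definition mean :: real where
  "mean = p * real d ^ l + (1 - p) * q * real d ^ k"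

lemma sum_cprob_exclusive:
  "v \<in> tree_vertices d \<Longrightarrow> (\<Sum>us\<in>jump_seqs n. cprob (trace exclusive_step v us)) = mean ^ n"
  unfolding mean_def by (rule sum_cprob_trace[OF local_exclusive_step cprob_exclusive_step])

lemma mean_nonneg: "0 \<le> mean"
  using p_nonneg p_le_1 q_nonneg by (simp add: mean_def)

text \<open>The second moment of the number of exclusive paths with \<open>n\<close> edges from
  \<open>v\<close>, expanded over pairs.\<close>

definition pair_sum :: "nat list \<Rightarrow> nat \<Rightarrow> real" where
  "pair_sum v n = (\<Sum>us\<in>jump_seqs n. \<Sum>vs\<in>jump_seqs n.
     cprob (trace exclusive_step v us \<union> trace exclusive_step v vs))"

text \<open>Pairs are split by their first jumps. Equal first jumps contribute that step once and
  leave a pair of paths of length \<open>n\<close>; different first jumps are handled by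
  \<open>cprob_exclusive_pair_le\<close>.\<close>

lemma pair_sum_le:
  assumes "1 < mean" "v \<in> tree_vertices d"
  shows "pair_sum v n \<le> mean ^ (2 * n) * (mean / (mean - 1))"
  using assms(2)
proof (induction n arbitrary: v)
  case 0
  then show ?case using assms(1) by (simp add: pair_sum_def cyl_empty M.prob_space)
next
  case (Suc n)
  let ?T = "trace exclusive_step"
  let ?c = "\<lambda>u. if length u = l then p else (1 - p) * q"
  have c_nonneg: "0 \<le> ?c u" for u using p_nonneg p_le_1 q_nonneg by simp
  \<comment> \<open>The last summand is kept also for \<open>u = u'\<close>, where it is only
    nonnegative slack, so that its sum over all pairs factorises with \<open>mean\<close>
    squared.\<close>
  have le: "(\<Sum>us\<in>jump_seqs n. \<Sum>vs\<in>jump_seqs n. cprob (?T v (u # us) \<union> ?T v (u' # vs)))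
    \<le> (if u = u' then ?c u * pair_sum (v @ u) n else 0) + ?c u * ?c u' * mean ^ (2 * n)"
    if u: "u \<in> jumps" "u' \<in> jumps" for u u'
  proof (cases "u = u'")
    case True
    have vu: "v @ u \<in> tree_vertices d" using u Suc.prems jumps_tree_vertices by blast
    have "cprob (?T v (u # us) \<union> ?T v (u # vs)) = ?c u * cprob (?T (v @ u) us \<union> ?T (v @ u) vs)"
      if "us \<in> jump_seqs n" "vs \<in> jump_seqs n" for us vs
    proof -
      have sub: "set us \<subseteq> jumps" "set vs \<subseteq> jumps" using that by (auto simp: jump_seqs_def)
      have "?T v (u # us) \<union> ?T v (u # vs)
        = exclusive_step v u \<union> (?T (v @ u) us \<union> ?T (v @ u) vs)" by auto
      moreover have "admissible (exclusive_step v u)"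
        using local_exclusive_step Suc.prems u by (auto simp: local_step_def)
      moreover have "admissible (?T (v @ u) us \<union> ?T (v @ u) vs)"
        using admissible_trace[OF local_exclusive_step vu] sub by simp
      moreover have "fst ` exclusive_step v u \<inter> fst ` (?T (v @ u) us \<union> ?T (v @ u) vs) = {}"
        using step_trace_disjoint[OF local_exclusive_step Suc.prems u(1)] sub
        by (simp add: image_Un Int_Un_distrib)
      ultimately show ?thesis
        using cprob_Un cprob_exclusive_step[OF Suc.prems u(1)] by simp
    qed
    then have "(\<Sum>us\<in>jump_seqs n. \<Sum>vs\<in>jump_seqs n. cprob (?T v (u # us) \<union> ?T v (u # vs)))
      = ?c u * pair_sum (v @ u) n"
      unfolding pair_sum_def sum_distrib_left by (intro sum.cong refl)
    then show ?thesis
      using True c_nonneg[of u] mean_nonneg by simp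
  next
    case False
    have vu: "v @ u \<in> tree_vertices d" "v @ u' \<in> tree_vertices d"
      using u Suc.prems jumps_tree_vertices by blast+
    have "(\<Sum>us\<in>jump_seqs n. \<Sum>vs\<in>jump_seqs n. cprob (?T v (u # us) \<union> ?T v (u' # vs)))
      \<le> (\<Sum>us\<in>jump_seqs n. \<Sum>vs\<in>jump_seqs n.
           (?c u * cprob (?T (v @ u) us)) * (?c u' * cprob (?T (v @ u') vs)))"
    proof (intro sum_mono)
      fix us vs assume "us \<in> jump_seqs n" "vs \<in> jump_seqs n"
      then have sub: "set us \<subseteq> jumps" "set vs \<subseteq> jumps" by (auto simp: jump_seqs_def)
      have "cprob (?T v (u # us) \<union> ?T v (u' # vs)) \<le> cprob (?T v (u # us)) * cprob (?T v (u' # vs))"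
        using cprob_exclusive_pair_le[OF Suc.prems, of "u # us" "u' # vs"] False u sub by simp
      also have "\<dots> = (?c u * cprob (?T (v @ u) us)) * (?c u' * cprob (?T (v @ u') vs))"
        by (simp only: cprob_trace_Cons[OF local_exclusive_step Suc.prems] u sub
          cprob_exclusive_step[OF Suc.prems])
      finally show "cprob (?T v (u # us) \<union> ?T v (u' # vs))
        \<le> (?c u * cprob (?T (v @ u) us)) * (?c u' * cprob (?T (v @ u') vs))" .
    qed
    also have "\<dots> = (?c u * mean ^ n) * (?c u' * mean ^ n)"
      by (simp only: sum_distrib_left[symmetric] sum_distrib_right[symmetric] sum_cprob_exclusive vu)
    also have "\<dots> = ?c u * ?c u' * mean ^ (2 * n)"
      unfolding mult_2 power_add by (simp only: mult_ac)
    finally show ?thesis using False by simp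
  qed
  have "pair_sum v (Suc n) = (\<Sum>u\<in>jumps. \<Sum>u'\<in>jumps. \<Sum>us\<in>jump_seqs n. \<Sum>vs\<in>jump_seqs n.
      cprob (?T v (u # us) \<union> ?T v (u' # vs)))"
    unfolding pair_sum_def sum_jump_seqs_Suc by (intro sum.cong refl sum.swap)
  also have "\<dots> \<le> (\<Sum>u\<in>jumps. \<Sum>u'\<in>jumps.
      (if u = u' then ?c u * pair_sum (v @ u) n else 0) + ?c u * ?c u' * mean ^ (2 * n))"
    by (intro sum_mono le)
  also have "\<dots> = (\<Sum>u\<in>jumps. ?c u * pair_sum (v @ u) n)
      + (\<Sum>u\<in>jumps. ?c u) * (\<Sum>u'\<in>jumps. ?c u') * mean ^ (2 * n)"
  proof -
    have "(\<Sum>u'\<in>jumps. if u = u' then ?c u * pair_sum (v @ u) n else 0) = ?c u * pair_sum (v @ u) n"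
      if "u \<in> jumps" for u
      using that sum.delta'[OF finite_jumps, of u "\<lambda>_. ?c u * pair_sum (v @ u) n"] by simp
    then show ?thesis
      unfolding sum_product by (simp only: sum.distrib sum_distrib_right cong: sum.cong)
  qed
  also have "(\<Sum>u\<in>jumps. ?c u) = mean"
    unfolding sum_jumps mean_def ..
  also have "(\<Sum>u\<in>jumps. ?c u * pair_sum (v @ u) n)
      \<le> (\<Sum>u\<in>jumps. ?c u * (mean ^ (2 * n) * (mean / (mean - 1))))"
    by (intro sum_mono mult_left_mono Suc.IH jumps_tree_vertices Suc.prems c_nonneg)
  also have "\<dots> = mean * (mean ^ (2 * n) * (mean / (mean - 1)))"
    unfolding sum_distrib_right[symmetric] sum_jumps mean_def ..
  finally have "pair_sum v (Suc n)
      \<le> mean * (mean ^ (2 * n) * (mean / (mean - 1))) + mean * mean * mean ^ (2 * n)" by simp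
  \<comment> \<open>The constant \<open>K = mean / (mean - 1)\<close> solves
    \<open>K / mean + 1 = K\<close>, which is what makes the bound reproduce itself.\<close>
  also have "\<dots> = mean ^ (2 * Suc n) * (mean / (mean - 1))"
    using assms(1) by (simp add: field_simps power2_eq_square)
  finally show ?case .
qed

text \<open>Second moment method. \<open>?N\<close> counts exclusive paths; these are open, so
  \<open>?N\<close> vanishes off \<open>long_path n\<close>. Expanding the square of
  \<open>?N - ?t\<close> on that event and taking expectations bounds its probability below.\<close>

lemma long_path_ge:
  assumes "1 < mean"
  shows "(mean - 1) / mean \<le> measure M (long_path n)"
proof -
  let ?J = "jump_seqs n"
  let ?A = "\<lambda>us. cyl (trace exclusive_step [] us)"
  let ?N = "\<lambda>\<omega>. \<Sum>us\<in>?J. indicator (?A us) \<omega> :: real"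
  let ?K = "mean / (mean - 1)"
  let ?t = "?K * mean ^ n"
  have A: "?A us \<in> sets M" if "us \<in> ?J" for us
    using that by (intro sets_cyl admissible_trace local_exclusive_step) (auto simp: jump_seqs_def)
  \<comment> \<open>A product of two path indicators is the indicator of an intersection, and by
    \<open>cyl_Un\<close> its expectation is a summand of \<open>pair_sum\<close>.\<close>
  have N2: "(?N \<omega>)\<^sup>2 = (\<Sum>us\<in>?J. \<Sum>vs\<in>?J. indicator (?A us \<inter> ?A vs) \<omega>)" for \<omega>
    by (simp add: power2_eq_square sum_product indicator_inter_arith)
  have int: "integrable M ?N" "integrable M (\<lambda>\<omega>. (?N \<omega>)\<^sup>2)"
      "integrable M (\<lambda>\<omega>. indicator (long_path n) \<omega> :: real)"
    unfolding N2 using A sets_long_path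
    by (auto intro!: Bochner_Integration.integrable_sum M.integrable_const_bound[where B = 1] simp: indicator_def)
  have EN: "integral\<^sup>L M ?N = mean ^ n"
  proof -
    have "integral\<^sup>L M ?N = (\<Sum>us\<in>?J. integral\<^sup>L M (indicator (?A us)))"
      using A by (intro Bochner_Integration.integral_sum)
        (auto intro!: M.integrable_const_bound[where B = 1] simp: indicator_def)
    also have "\<dots> = (\<Sum>us\<in>?J. cprob (trace exclusive_step [] us))"
      using A by (intro sum.cong) auto
    finally show ?thesis using sum_cprob_exclusive by simp
  qed
  have EN2: "integral\<^sup>L M (\<lambda>\<omega>. (?N \<omega>)\<^sup>2) = pair_sum [] n"
  proof -
    have ind: "integrable M (\<lambda>\<omega>. indicator (?A us \<inter> ?A vs) \<omega> :: real)"
      if "us \<in> ?J" "vs \<in> ?J" for us vs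
      using A that by (auto intro!: M.integrable_const_bound[where B = 1] simp: indicator_def)
    have "integral\<^sup>L M (\<lambda>\<omega>. (?N \<omega>)\<^sup>2)
      = (\<Sum>us\<in>?J. integral\<^sup>L M (\<lambda>\<omega>. \<Sum>vs\<in>?J. indicator (?A us \<inter> ?A vs) \<omega>))"
      unfolding N2 by (intro Bochner_Integration.integral_sum Bochner_Integration.integrable_sum ind)
    also have "\<dots> = (\<Sum>us\<in>?J. \<Sum>vs\<in>?J. integral\<^sup>L M (indicator (?A us \<inter> ?A vs)))"
      by (intro sum.cong refl Bochner_Integration.integral_sum ind)
    also have "\<dots> = pair_sum [] n"
      unfolding pair_sum_def cyl_Un using A by (intro sum.cong) auto
    finally show ?thesis .
  qed
  \<comment> \<open>The value of \<open>?t\<close> minimises the integral of this expression when the second moment bound is sharp.\<close>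
  have "0 \<le> (?N \<omega>)\<^sup>2 - 2 * ?t * ?N \<omega> + ?t\<^sup>2 * indicator (long_path n) \<omega>" for \<omega>
  proof (cases "\<omega> \<in> long_path n")
    case True
    have "0 \<le> (?N \<omega> - ?t)\<^sup>2" by simp
    then show ?thesis using True by (simp add: power2_diff mult_ac)
  next
    case False
    then have "\<omega> \<notin> ?A us" if "us \<in> ?J" for us
      using that cyl_mono[OF trace_open_subset_exclusive] by (auto simp: long_path_def)
    then have "?N \<omega> = 0" by (intro sum.neutral) auto
    then show ?thesis by simp
  qed
  then have "0 \<le> integral\<^sup>L M (\<lambda>\<omega>. (?N \<omega>)\<^sup>2 - 2 * ?t * ?N \<omega> + ?t\<^sup>2 * indicator (long_path n) \<omega>)"
    by (rule Bochner_Integration.integral_nonneg)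
  also have "\<dots> = pair_sum [] n - 2 * ?t * mean ^ n + ?t\<^sup>2 * measure M (long_path n)"
    using int sets_long_path by (simp add: EN EN2 del: sum_mult_indicator)
  also have "\<dots> \<le> mean ^ (2 * n) * ?K - 2 * ?t * mean ^ n + ?t\<^sup>2 * measure M (long_path n)"
    using pair_sum_le[OF assms, of "[]" n] by simp
  \<comment> \<open>Inserting \<open>?t\<close>, the three terms become
    \<open>mean ^ (2 * n) * ?K\<close> times 1, -2 and \<open>?K\<close> times the probability of
    \<open>long_path n\<close>.\<close>
  also have "\<dots> = mean ^ (2 * n) * ?K * (?K * measure M (long_path n) - 1)"
  proof -
    have "a * a * c - 2 * (c * a) * a + (c * a)\<^sup>2 * x = a * a * c * (c * x - 1)" for a c x :: real
      by (simp add: power2_eq_square algebra_simps)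
    then show ?thesis unfolding mult_2 power_add .
  qed
  finally have "0 \<le> mean ^ (2 * n) * ?K * (?K * measure M (long_path n) - 1)" .
  moreover have "0 < mean ^ (2 * n) * ?K" using assms by simp
  ultimately have "0 \<le> ?K * measure M (long_path n) - 1" by (metis mult_pos_neg not_le)
  then show ?thesis using assms by (simp add: field_simps)
qed

lemma theta_pos:
  assumes "1 < p * real d ^ l + (1 - p) * q * real d ^ k"
  shows "0 < theta d l k p q"
proof -
  have m: "1 < mean" using assms by (simp add: mean_def)
  then have "(mean - 1) / mean \<le> theta d l k p q"
    using LIMSEQ_le_const[OF long_path_tendsto_theta] long_path_ge by blast
  moreover have "0 < (mean - 1) / mean" using m by simp
  ultimately show ?thesis by linarith
qed

end

section \<open>Bounds for the critical parameter\<close>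

theorem proposition1:
  fixes d l k :: nat and p :: real
  assumes "2 \<le> d" and "1 \<le> l" and "l < k"
    and "p \<in> {0..1 / real d ^ l}"
  shows "(1 - p * real d ^ l) / real d ^ k \<le> q_crit d l k p
       \<and> q_crit d l k p \<le> (1 - p * real d ^ l) / ((1 - p) * real d ^ k)"
proof -
  let ?Q = "{q. 0 < q \<and> q < 1 \<and> theta d l k p q > 0}"
  let ?q0 = "(1 - p * real d ^ l) / ((1 - p) * real d ^ k)"
  have dl: "1 < real d ^ l" and dk: "1 < real d ^ k"
    using assms by (auto intro!: one_less_power)
  have dl0: "0 < real d ^ l" and dk0: "0 < real d ^ k" using dl dk by linarith+
  then have p0: "0 \<le> p" and pdl: "p * real d ^ l \<le> 1"
    using assms(4) pos_le_divide_eq[of "real d ^ l" p 1] by (auto simp del: zero_less_power)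
  have "p \<le> 1 / real d ^ l" using assms(4) by simp
  also have "\<dots> < 1" using dl pos_divide_less_eq[OF dl0, of 1 1] by simp
  finally have p1: "p < 1" .
  then have denom: "0 < (1 - p) * real d ^ k" using dk0 by (intro mult_pos_pos) auto
  have perc: "two_range_percolation l k p q" if "0 < q" "q < 1" for q
    using that assms p0 p1 by unfold_locales auto
  have sup: "q \<in> ?Q" if "?q0 < q" "q < 1" "0 < q" for q
  proof -
    interpret two_range_percolation d l k p q using perc that by blast
    have "1 - p * real d ^ l < q * ((1 - p) * real d ^ k)"
      using that(1) pos_divide_less_eq[OF denom] by blast
    then show ?thesis using that theta_pos by (simp add: mult_ac)
  qed
  have q0: "0 \<le> ?q0" using pdl denom by (intro divide_nonneg_pos) auto
  \<comment> \<open>The upper bound must lie strictly below 1: otherwise no \<open>q < 1\<close>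
    above it would be available to show that \<open>?Q\<close> is nonempty.\<close>
  have "1 - p * real d ^ l \<le> 1 - p" using mult_left_mono[OF less_imp_le[OF dl] p0] by simp
  also have "\<dots> < (1 - p) * real d ^ k" using mult_strict_left_mono[OF dk, of "1 - p"] p1 by simp
  finally have q0_1: "?q0 < 1" using pos_divide_less_eq[OF denom, of _ 1] by simp
  have sub: "(1 - p * real d ^ l) / real d ^ k \<le> q" if "q \<in> ?Q" for q
  proof -
    interpret two_range_percolation d l k p q using perc that by blast
    have "1 \<le> p * real d ^ l + q * real d ^ k"
      using theta_eq_0 that by fastforce
    then show ?thesis using pos_divide_le_eq[OF dk0] by simp
  qed
  have ne: "?Q \<noteq> {}" using dense[OF q0_1] sup q0 by fastforce
  have bdd: "bdd_below ?Q" by (rule bdd_belowI[of _ 0]) auto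
  \<comment> \<open>The value \<open>?q0\<close> itself is not shown to percolate, and it is 0 when
    \<open>p * d ^ l = 1\<close>; hence it is approached from above.\<close>
  have "q_crit d l k p \<le> q" if "?q0 < q" "q < 1" for q
    unfolding q_crit_def using that q0 by (intro cInf_lower bdd sup) auto
  then have "q_crit d l k p \<le> ?q0" using dense_ge_bounded[OF q0_1] by blast
  moreover have "(1 - p * real d ^ l) / real d ^ k \<le> q_crit d l k p"
    unfolding q_crit_def using ne sub by (intro cInf_greatest) auto
  ultimately show ?thesis by blast
qed

end
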